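(* Let $G$ be a $2$-connected graph that is $\{P_5, W^{*}\}$-free. Then $G$ contains a longest cycle (i.e. a cycle of maximum length among all cycles of $G$) which is a dominating cycle of $G$.
   Context: All graphs are finite and simple. A cycle $C$ in a graph $G$ is dominating if every edge of $G$ is incident with a vertex of $C$. For a set $\mathcal{H}$ of connected graphs, $G$ is $\mathcal{H}$-free if $G$ does not contain any member of $\mathcal{H}$ as an induced subgraph. $P_5$ is the path of order $5$ (five vertices). $W^{*}$ is the graph of order $6$ obtained from two triangles and an edge (i.e. a $K_2$), which are pairwise disjoint, by identifying one vertex in each; that is, $W^{*}$ has vertices $c,a_1,a_2,b_1,b_2,d$ and edges $ca_1,ca_2,a_1a_2,cb_1,cb_2,b_1b_2,cd$. *)

theory Defs
  imports "Graph_Theory.Graph_Theory"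
begin

text \<open>
  A finite simple graph is a \<^locale>\<open>pair_graph\<close>: a finite vertex set together with a symmetric
  irreflexive relation, an undirected edge \<open>uv\<close> being the pair of arcs \<open>(u, v)\<close>, \<open>(v, u)\<close>.
\<close>

text \<open>
  The condition on the order rules out complete graphs on at most \<open>k\<close> vertices; in particular a
  2-connected graph has at least three vertices.
\<close>

definition k_connected :: "nat \<Rightarrow> 'a pair_pre_digraph \<Rightarrow> bool" where
  "k_connected k G \<longleftrightarrow>
     k < card (pverts G) \<and>
     (\<forall>X \<subseteq> pverts G. card X < k \<longrightarrow> Digraph_Component.connected (with_proj G \<restriction> (pverts G - X)))"

definition has_induced :: "'b pair_pre_digraph \<Rightarrow> 'a pair_pre_digraph \<Rightarrow> bool" where
  "has_induced H G \<longleftrightarrow>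
     (\<exists>K. induced_subgraph K (with_proj G) \<and> digraph_iso (with_proj H) K)"

definition induced_free :: "'b pair_pre_digraph set \<Rightarrow> 'a pair_pre_digraph \<Rightarrow> bool" where
  "induced_free \<H> G \<longleftrightarrow> (\<forall>H \<in> \<H>. \<not> has_induced H G)"

definition path_graph :: "nat \<Rightarrow> nat pair_pre_digraph" where
  "path_graph n =
     \<lparr>pverts = {..<n}, parcs = {(i, j). i < n \<and> j < n \<and> (j = Suc i \<or> i = Suc j)}\<rparr>"

text \<open>
  Two triangles \<open>0 1 2\<close> and \<open>0 3 4\<close> and an edge \<open>0 5\<close> sharing exactly the vertex \<open>0\<close>.
\<close>

definition W_star :: "nat pair_pre_digraph" where
  "W_star =
     (let E = {(0, 1), (0, 2), (1, 2), (0, 3), (0, 4), (3, 4), (0, 5)}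
      in \<lparr>pverts = {0, 1, 2, 3, 4, 5}, parcs = E \<union> E\<inverse>\<rparr>)"

text \<open>
  In a symmetric digraph the closed walk \<open>u v u\<close> along a single edge also satisfies
  \<^const>\<open>pre_digraph.cycle\<close>; the bound on the length excludes it.
\<close>

definition graph_cycle :: "'a pair_pre_digraph \<Rightarrow> ('a \<times> 'a) awalk \<Rightarrow> bool" where
  "graph_cycle G C \<longleftrightarrow> pre_digraph.cycle (with_proj G) C \<and> 3 \<le> length C"

text \<open>On a closed walk every vertex is the tail of some arc.\<close>

definition cycle_verts :: "('a \<times> 'a) awalk \<Rightarrow> 'a set" where
  "cycle_verts C = fst ` set C"

definition longest_cycle :: "'a pair_pre_digraph \<Rightarrow> ('a \<times> 'a) awalk \<Rightarrow> bool" where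
  "longest_cycle G C \<longleftrightarrow>
     graph_cycle G C \<and> (\<forall>C'. graph_cycle G C' \<longrightarrow> length C' \<le> length C)"

definition dominating_cycle :: "'a pair_pre_digraph \<Rightarrow> ('a \<times> 'a) awalk \<Rightarrow> bool" where
  "dominating_cycle G C \<longleftrightarrow>
     graph_cycle G C \<and> (\<forall>e \<in> parcs G. fst e \<in> cycle_verts C \<or> snd e \<in> cycle_verts C)"

lemma pair_graph_path_graph: "pair_graph (path_graph n)"
proof -
  have "parcs (path_graph n) \<subseteq> {..<n} \<times> {..<n}"
    by (auto simp: path_graph_def)
  then have "finite (parcs (path_graph n))"
    by (rule finite_subset) simp
  then show ?thesis
    by unfold_locales (auto simp: path_graph_def symmetric_def intro!: symI)
qed

lemma pair_graph_W_star: "pair_graph W_star"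
  by unfold_locales (auto simp: W_star_def Let_def symmetric_def intro!: symI)

lemma cycle_verts_eq:
  assumes "graph_cycle G C"
  obtains u where "pre_digraph.awalk (with_proj G) u C u"
    and "cycle_verts C = set (pre_digraph.awalk_verts (with_proj G) u C)"
proof -
  have ends: "set (pawalk_verts u p) = insert v (fst ` set p)" if "pcas u p v"
    for u v :: 'a and p
    using that by (induction p arbitrary: u) auto
  from assms obtain u where u: "pre_digraph.awalk (with_proj G) u C u" and "C \<noteq> []"
    by (auto simp: graph_cycle_def pre_digraph.cycle_def)
  then have "pcas u C u"
    by (simp add: pre_digraph.awalk_def cas_with_proj_eq)
  moreover from this \<open>C \<noteq> []\<close> have "u \<in> fst ` set C"
    by (cases C) auto
  ultimately have "cycle_verts C = set (pre_digraph.awalk_verts (with_proj G) u C)"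
    by (auto simp: cycle_verts_def awalk_verts_with_proj_eq dest: ends)
  with u show ?thesis by (rule that)
qed

lemma has_induced_iff:
  assumes "pair_wf_digraph H" "pair_wf_digraph G"
  shows "has_induced H G \<longleftrightarrow>
    (\<exists>f. inj_on f (pverts H) \<and> f ` pverts H \<subseteq> pverts G \<and>
      (\<forall>u \<in> pverts H. \<forall>v \<in> pverts H. (u, v) \<in> parcs H \<longleftrightarrow> (f u, f v) \<in> parcs G))"
  (is "_ \<longleftrightarrow> ?R")
proof
  interpret H: pair_wf_digraph H by fact
  interpret G: pair_wf_digraph G by fact
  {
    assume "has_induced H G"
    then obtain h K where K: "induced_subgraph K (with_proj G)"
      and h: "pre_digraph.digraph_isomorphism (with_proj H) h" and Kh: "K = app_iso h (with_proj H)"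
      by (auto simp: has_induced_def digraph_iso_def)
    let ?f = "iso_verts h"
    have inj: "inj_on ?f (pverts H)"
      and arcs: "\<And>a. a \<in> parcs H \<Longrightarrow> ?f (fst a) = iso_tail h (iso_arcs h a) \<and>
        ?f (snd a) = iso_head h (iso_arcs h a)"
      using h by (auto simp: pre_digraph.digraph_isomorphism_def)
    have sub: "?f ` pverts H \<subseteq> pverts G"
      and aK: "iso_arcs h ` parcs H = {e \<in> parcs G. fst e \<in> ?f ` pverts H \<and> snd e \<in> ?f ` pverts H}"
      and comp: "\<And>e. e \<in> iso_arcs h ` parcs H \<Longrightarrow> iso_tail h e = fst e \<and> iso_head h e = snd e"
      using K by (auto simp: Kh induced_subgraph_def subgraph_def compatible_def)
    have iso: "iso_arcs h a = (?f (fst a), ?f (snd a))" if "a \<in> parcs H" for a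
      using arcs[OF that] comp[OF imageI[OF that]] by (simp add: prod_eq_iff)
    have "(u, v) \<in> parcs H \<longleftrightarrow> (?f u, ?f v) \<in> parcs G"
      if uv: "u \<in> pverts H" "v \<in> pverts H" for u v
    proof
      assume "(u, v) \<in> parcs H"
      then have "iso_arcs h (u, v) \<in> parcs G" using aK by blast
      then show "(?f u, ?f v) \<in> parcs G" using iso \<open>(u, v) \<in> parcs H\<close> by simp
    next
      assume "(?f u, ?f v) \<in> parcs G"
      then have "(?f u, ?f v) \<in> iso_arcs h ` parcs H" using aK uv by auto
      then obtain a where a: "a \<in> parcs H" "iso_arcs h a = (?f u, ?f v)" by auto
      then have "?f (fst a) = ?f u" "?f (snd a) = ?f v" using iso by auto
      then have "a = (u, v)"
        using inj uv a(1) H.arc_fst_in_verts H.arc_snd_in_verts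
        by (auto simp: prod_eq_iff dest: inj_onD)
      with a(1) show "(u, v) \<in> parcs H" by simp
    qed
    with inj sub show ?R by blast
  next
    assume ?R
    then obtain f where f: "inj_on f (pverts H)" "f ` pverts H \<subseteq> pverts G"
      and adj: "\<And>u v. u \<in> pverts H \<Longrightarrow> v \<in> pverts H \<Longrightarrow>
        (u, v) \<in> parcs H \<longleftrightarrow> (f u, f v) \<in> parcs G"
      by blast
    let ?h = "\<lparr>iso_verts = f, iso_arcs = map_prod f f, iso_head = snd, iso_tail = fst\<rparr>"
    have "inj_on (map_prod f f) (parcs H)"
      by (rule inj_on_subset[OF map_prod_inj_on[OF f(1) f(1)]])
        (auto dest: H.in_arcsD1 H.in_arcsD2)
    then have "pre_digraph.digraph_isomorphism (with_proj H) ?h"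
      using f(1) by (simp add: pre_digraph.digraph_isomorphism_def H.wf_digraph_axioms H.wf_digraph)
    moreover have "map_prod f f ` parcs H =
        {e \<in> parcs G. fst e \<in> f ` pverts H \<and> snd e \<in> f ` pverts H}"
      (is "?A = ?B")
    proof
      show "?A \<subseteq> ?B"
        using adj by (auto dest: H.in_arcsD1 H.in_arcsD2)
      show "?B \<subseteq> ?A"
      proof (clarsimp)
        fix u v assume "(f u, f v) \<in> parcs G" "u \<in> pverts H" "v \<in> pverts H"
        then have "(u, v) \<in> parcs H" by (simp add: adj)
        then show "(f u, f v) \<in> map_prod f f ` parcs H" by (force simp: image_iff)
      qed
    qed
    then have "app_iso ?h (with_proj H) = with_proj G \<restriction> (f ` pverts H)"
      by (simp add: app_iso_def induce_subgraph_def)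
    moreover have "induced_subgraph (with_proj G \<restriction> (f ` pverts H)) (with_proj G)"
      by (rule G.induced_induce) (use f(2) in simp)
    ultimately show "has_induced H G"
      unfolding has_induced_def digraph_iso_def by metis
  }
qed

end

theory Submission
  imports Defs
begin

text \<open>
  Among the longest cycles choose one, \<open>C\<close>, that misses the fewest edges, an edge being missed if
  both its ends lie off \<open>C\<close>. Maximal length alone does not make a cycle dominating; the second
  extremality is what allows exchanges: a cycle of the same length that picks up an end of a missed
  edge and gives up only vertices whose neighbours all lie on the new cycle misses fewer edges
  (\<open>no_exchange\<close>).

  Suppose an edge is missed, and let \<open>H\<close> be its component off \<open>C\<close>. By 2-connectivity there are disjoint
  edges \<open>uh\<close>, \<open>vk\<close> from \<open>C\<close> to \<open>H\<close>; take them with the arc \<open>A\<close> of \<open>C\<close> from \<open>u\<close> to \<open>v\<close> as short as possible,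
  so that no vertex inside \<open>A\<close> has a neighbour in \<open>H\<close>. Let \<open>B\<close> be the arc back from \<open>v\<close> to \<open>u\<close>. A path
  from \<open>u\<close> to \<open>v\<close> through \<open>H\<close> has at least two inner vertices, so every path from \<open>u\<close> to \<open>v\<close> along
  vertices of \<open>C\<close> leaves out at least two vertices of \<open>C\<close> (\<open>detour\<close>), and if it leaves out exactly two
  nonadjacent ones, then one of them has a neighbour off \<open>C\<close> (\<open>detour_misses_two\<close>). All the work consists
  in producing paths that violate this.

  If \<open>u\<close> is adjacent to some but not all of \<open>H\<close>, there is an edge \<open>hk\<close> of \<open>H\<close> with \<open>uh\<close> an edge and \<open>uk\<close> not.
  The induced paths \<open>x u h k\<close> then force \<open>u\<close> to be adjacent to all of \<open>A\<close> and to the last two vertices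
  of \<open>B\<close>; a \<open>W\<^sup>*\<close> centred at \<open>u\<close> is avoided only by a chord that yields a path leaving out just the two
  neighbours of \<open>u\<close> on \<open>C\<close> (\<open>no_mixed_attachment\<close>).

  Hence \<open>u\<close> and \<open>v\<close> are both adjacent to both ends of a missed edge \<open>hk\<close> (a \<open>lens\<close>). With the triangles
  \<open>uhk\<close> and \<open>vhk\<close> at hand, \<open>W\<^sup>*\<close>-freeness says that the remaining neighbours of \<open>u\<close> (or of \<open>v\<close>), away from
  \<open>h\<close> and \<open>k\<close>, induce a complete multipartite graph. This and \<open>P\<^sub>5\<close>-freeness show that \<open>u\<close> and \<open>v\<close> are
  adjacent, that the cycle neighbours of \<open>u\<close> and \<open>v\<close> have no neighbours off \<open>C\<close>, and that the two cycle
  vertices next to \<open>u\<close> on either side are adjacent to \<open>u\<close> and not to \<open>v\<close>, and vice versa. So somewhere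
  along \<open>B\<close> adjacency to \<open>v\<close> turns into adjacency to \<open>u\<close>; \<open>P\<^sub>5\<close>-freeness makes this happen between two
  consecutive vertices, and the corresponding path leaves out at most the last vertices of \<open>A\<close> and of \<open>B\<close>
  (\<open>lens_no_switch\<close>, \<open>no_lens\<close>).
\<close>

section \<open>Cycles as vertex lists\<close>

locale sym_rel =
  fixes E :: "'a \<Rightarrow> 'a \<Rightarrow> bool"
  assumes sym: "E x y \<Longrightarrow> E y x"
    and irrefl [simp]: "\<not> E x x"
begin

definition cyc :: "'a list \<Rightarrow> bool" where
  "cyc xs \<longleftrightarrow> 3 \<le> length xs \<and> distinct xs \<and> successively E xs \<and> E (last xs) (hd xs)"

lemma E_commute: "E x y \<longleftrightarrow> E y x"
  using sym by blast

lemma successively_rev_E [simp]: "successively E (rev xs) \<longleftrightarrow> successively E xs"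
  by (subst successively_rev) (rule successively_cong, auto simp: E_commute)

declare successively_rev [simp del]

lemma cyc_append_commute:
  assumes "cyc (xs @ ys)" shows "cyc (ys @ xs)"
  using assms by (cases "xs = [] \<or> ys = []") (auto simp: cyc_def successively_append_iff)

lemma cyc_rev: "cyc (rev xs) \<longleftrightarrow> cyc xs"
  by (cases "xs = []") (auto simp: cyc_def hd_rev last_rev E_commute)

end

lemma two_le_lengthE:
  assumes "2 \<le> length xs" obtains x y zs where "xs = x # y # zs"
  using assms by (auto simp: Suc_le_length_iff numeral_2_eq_2)

section \<open>Detours around an extremal cycle\<close>

text \<open>
  The vertices named in either condition are automatically distinct: any coincidence turns one of the
  required adjacencies into one of the listed chords or a loop.
\<close>

locale P5_W_free = sym_rel +
  assumes no_P5: "\<lbrakk>E a b; E b c; E c d; E d e\<rbrakk> \<Longrightarrow> E a c \<or> E a d \<or> E a e \<or> E b d \<or> E b e \<or> E c e"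
    and no_W: "\<lbrakk>E c a1; E c a2; E a1 a2; E c b1; E c b2; E b1 b2; E c d\<rbrakk> \<Longrightarrow>
      E a1 b1 \<or> E a1 b2 \<or> E a2 b1 \<or> E a2 b2 \<or> E d a1 \<or> E d a2 \<or> E d b1 \<or> E d b2"

text \<open>
  \<open>X\<close> is the vertex set of a longest cycle that misses the fewest edges. Only these two consequences of
  the choice matter, so the cycle itself is left open: the same \<open>X\<close> may carry many cycles.
\<close>

locale extremal_cycle = P5_W_free +
  fixes X :: "'a set"
  assumes longest: "cyc ys \<Longrightarrow> length ys \<le> card X"
    and no_exchange: "\<lbrakk>cyc ys; length ys = card X;
        \<And>x y. \<lbrakk>x \<in> X - set ys; E x y\<rbrakk> \<Longrightarrow> y \<in> set ys;
        h \<in> set ys - X; k \<notin> X\<rbrakk> \<Longrightarrow> \<not> E h k"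
begin

text \<open>
  The cycle is read as \<open>u\<close>, arc \<open>A\<close>, \<open>v\<close>, arc \<open>B\<close>. Exchanging \<open>u\<close> with \<open>v\<close> and reversing the direction generate the
  symmetries by which every statement about the start of \<open>A\<close> yields one about each of the four arc ends.
\<close>

definition cut :: "'a \<Rightarrow> 'a list \<Rightarrow> 'a \<Rightarrow> 'a list \<Rightarrow> bool" where
  "cut u A v B \<longleftrightarrow> cyc (u # A @ v # B) \<and> set (u # A @ v # B) = X"

lemma cut_swap: "cut u A v B \<Longrightarrow> cut v B u A"
  using cyc_append_commute[of "u # A" "v # B"] by (auto simp: cut_def)

lemma cut_reflect: 
  assumes "cut u A v B" shows "cut u (rev B) v (rev A)"
proof -
  have "cyc (rev (A @ v # B) @ [u])" using assms cyc_rev[of "u # A @ v # B"] by (simp add: cut_def)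
  then show ?thesis
    using assms cyc_append_commute[of "rev (A @ v # B)" "[u]"] by (auto simp: cut_def)
qed

lemma card_cut: "cut u A v B \<Longrightarrow> card X = length A + length B + 2"
  using distinct_card[of "u # A @ v # B"] by (auto simp: cut_def cyc_def)

lemma cut_edges:
  assumes "cut u A v B"
  shows "successively E (u # A @ [v])" "successively E (v # B @ [u])"
proof -
  have s: "successively E (u # A @ v # B)" and l: "E (last (v # B)) u"
    using assms by (auto simp: cut_def cyc_def)
  show "successively E (u # A @ [v])"
    using s successively_append_iff[of E "u # A @ [v]" B] by simp
  have "successively E (v # B)"
    using s successively_append_iff[of E "u # A" "v # B"] by simp
  then show "successively E (v # B @ [u])"
    using l successively_append_iff[of E "v # B" "[u]"] by simp
qed

text \<open>
  At least two inner vertices: this is where disjointness of the two edges from the component to the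
  cycle enters all length counts.
\<close>

definition bridge :: "'a \<Rightarrow> 'a list \<Rightarrow> 'a \<Rightarrow> bool" where
  "bridge u P v \<longleftrightarrow> 2 \<le> length P \<and> distinct P \<and> set P \<inter> X = {} \<and> successively E (u # P @ [v])"

lemma bridge_rev: "bridge u P v \<Longrightarrow> bridge v (rev P) u"
  using successively_rev_E[of "u # P @ [v]"] by (simp add: bridge_def)

lemma bridge_cyc:
  assumes "bridge u P v" "distinct (u # M @ [v])" "successively E (u # M @ [v])"
    "u \<in> X" "v \<in> X" "set M \<inter> set P = {}"
  shows "cyc (u # M @ v # rev P)"
proof -
  have "P \<noteq> []" using assms by (auto simp: bridge_def)
  moreover have "successively E (rev (u # P @ [v]))"
    using assms(1) by (simp only: successively_rev_E bridge_def)
  ultimately have "successively E (v # rev P)" "E (last (rev P)) u"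
    by (auto simp: successively_append_iff last_rev bridge_def successively_Cons)
  moreover have "successively E ((u # M @ [v]) @ rev P)"
    using \<open>P \<noteq> []\<close> assms(3) calculation successively_append_iff[of E "[v]" "rev P"]
    by (simp only: successively_append_iff[of E "u # M @ [v]"]) simp
  ultimately show ?thesis
    using assms \<open>P \<noteq> []\<close> by (auto simp: cyc_def bridge_def Suc_le_eq)
qed

text \<open>
  Closing the path \<open>M\<close> by the bridge gives a cycle, which is not longer than the extremal one. The path
  \<open>M\<close> may leave the cycle, as long as it avoids the bridge.
\<close>

lemma detour:
  assumes "cut u A v B" "bridge u P v"
    and "distinct M" "u \<notin> set M" "v \<notin> set M" "set M \<inter> set P = {}" "successively E (u # M @ [v])"
  shows "length M + 2 \<le> length A + length B"
proof -
  have "cyc (u # M @ v # rev P)"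
    by (rule bridge_cyc) (use assms in \<open>auto simp: cut_def cyc_def\<close>)
  from longest[OF this] card_cut[OF assms(1)] assms(2) show ?thesis
    by (simp add: bridge_def)
qed

text \<open>
  Equality in the length bound gives another longest cycle, and then the exchange condition applies to
  the two vertices left out.
\<close>

lemma detour_misses_two:
  assumes cut: "cut u A v B" and bridge: "bridge u P v" and k: "h \<in> set P" "E h k" "k \<notin> X"
    and M: "distinct M" "set M \<subseteq> set A \<union> set B" "successively E (u # M @ [v])"
    and len: "length A + length B \<le> length M + 2"
    and missed: "set A \<union> set B \<subseteq> set M \<union> {x, y}" "\<not> E x y"
      "\<And>z. z \<notin> X \<Longrightarrow> \<not> E x z" "\<And>z. z \<notin> X \<Longrightarrow> \<not> E y z"
  shows False
proof -
  have X: "X = {u, v} \<union> set A \<union> set B" and d: "distinct (u # A @ v # B)"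
    using cut by (auto simp: cut_def cyc_def)
  have uv: "u \<notin> set M" "v \<notin> set M" "u \<noteq> v"
    using d M(2) by auto
  have P: "set P \<inter> X = {}" using bridge by (auto simp: bridge_def)
  have cyc: "cyc (u # M @ v # rev P)"
    by (rule bridge_cyc) (use bridge M uv P X in auto)
  show False
  proof (rule no_exchange[OF cyc, THEN notE])
    show "length (u # M @ v # rev P) = card X"
      using longest[OF cyc] card_cut[OF cut] len bridge by (simp add: bridge_def)
    show "E h k" "k \<notin> X" "h \<in> set (u # M @ v # rev P) - X"
      using k P by auto
    fix w z assume w: "w \<in> X - set (u # M @ v # rev P)" "E w z"
    then have "w = x \<or> w = y" using missed(1) X by auto
    then have "z \<in> X" "z \<noteq> x" "z \<noteq> y" using w(2) missed(2-4) sym irrefl by metis+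
    then show "z \<in> set (u # M @ v # rev P)" using missed(1) X by auto
  qed
qed

text \<open>
  The other arc, traversed backwards, is itself a detour.
\<close>

lemma arc_length:
  assumes "cut u A v B" "bridge u P v"
  shows "2 \<le> length A" "2 \<le> length B"
proof -
  have *: "2 \<le> length A" if "cut u A v B" "bridge u P v" for u A v B P
  proof -
    have "successively E (rev (v # B @ [u]))"
      unfolding successively_rev_E by (rule cut_edges(2)[OF that(1)])
    with that have "length (rev B) + 2 \<le> length A + length B"
      by (intro detour) (auto simp: cut_def cyc_def bridge_def)
    then show ?thesis by simp
  qed
  show "2 \<le> length A" by (rule *) fact+
  show "2 \<le> length B" by (rule *[OF cut_swap[OF assms(1)] bridge_rev[OF assms(2)]])
qed

lemma arc_edges:
  assumes "cut u A v B" "A \<noteq> []" "B \<noteq> []"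
  shows "E u (hd A)" "E (last A) v" "successively E A" "E v (hd B)" "E u (last B)" "successively E B"
proof -
  have "successively E ((u # A) @ [v])" "successively E ((v # B) @ [u])"
    using cut_edges[OF assms(1)] by simp_all
  then show "E u (hd A)" "E (last A) v" "successively E A" "E v (hd B)" "E u (last B)" "successively E B"
    using assms(2,3) by (simp_all add: successively_append_iff successively_Cons E_commute)
qed

text \<open>
  Replacing the start \<open>A0\<close> of an arc by a longer path outside the cycle would lengthen the cycle.
\<close>

lemma no_bypass:
  assumes cut: "cut u (A0 @ A1) v B" and "A1 \<noteq> []" "length A0 < length Z"
    and Z: "distinct Z" "set Z \<inter> X = {}"
  shows "\<not> successively E (u # Z @ [hd A1])"
proof
  assume e: "successively E (u # Z @ [hd A1])"
  have "cyc (u # Z @ A1 @ v # B)"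
    using cut e Z assms(2,3)
    by (auto simp: cut_def cyc_def successively_append_iff successively_Cons hd_append)
  from longest[OF this] card_cut[OF cut] assms(3) show False by simp
qed

section \<open>Two cycle vertices with two adjacent common neighbours off the cycle\<close>

text \<open>
  Both ends of the edge \<open>hk\<close> off the cycle are common neighbours of \<open>u\<close> and \<open>v\<close>, so \<open>h k\<close> is a bridge and \<open>uhk\<close>,
  \<open>vhk\<close> are triangles ready to take part in a \<open>W\<^sup>*\<close>.
\<close>

definition lens :: "'a \<Rightarrow> 'a list \<Rightarrow> 'a \<Rightarrow> 'a list \<Rightarrow> 'a \<Rightarrow> 'a \<Rightarrow> bool" where
  "lens u A v B h k \<longleftrightarrow> cut u A v B \<and> h \<notin> X \<and> k \<notin> X \<and> E h k \<and> E u h \<and> E u k \<and> E v h \<and> E v k"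

lemma lens_swap: "lens u A v B h k \<Longrightarrow> lens v B u A h k"
  using cut_swap[of u A v B] by (simp add: lens_def)

lemma lens_reflect: "lens u A v B h k \<Longrightarrow> lens u (rev B) v (rev A) h k"
  using cut_reflect[of u A v B] by (simp add: lens_def)

lemma lens_turn: "lens u A v B h k \<Longrightarrow> lens v (rev A) u (rev B) h k"
  using lens_swap[OF lens_reflect] .

lemma lens_flip: "lens u A v B h k \<Longrightarrow> lens u A v B k h"
  by (auto simp: lens_def E_commute)

lemma lens_bridge: "lens u A v B h k \<Longrightarrow> bridge u [h, k] v"
  by (auto simp: lens_def bridge_def E_commute)

lemma lens_lengths:
  assumes "lens u A v B h k" shows "2 \<le> length A" "2 \<le> length B"
  using assms arc_length[OF _ lens_bridge] by (auto simp: lens_def)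

lemma lens_edges:
  assumes "lens u A v B h k"
  shows "E u (hd A)" "E (last A) v" "successively E A" "E v (hd B)" "E u (last B)" "successively E B"
    "E u h" "E u k" "E v h" "E v k" "E h k" "h \<notin> X" "k \<notin> X"
proof -
  have "A \<noteq> []" "B \<noteq> []" using lens_lengths[OF assms] by auto
  then show "E u (hd A)" "E (last A) v" "successively E A" "E v (hd B)" "E u (last B)" "successively E B"
    using assms arc_edges[of u A v B] by (simp_all add: lens_def)
  show "E u h" "E u k" "E v h" "E v k" "E h k" "h \<notin> X" "k \<notin> X"
    using assms by (simp_all add: lens_def)
qed

lemma lens_X:
  assumes "lens u A v B h k"
  shows "X = {u, v} \<union> set A \<union> set B" "distinct (u # A @ v # B)"
  using assms by (auto simp: lens_def cut_def cyc_def)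

lemma lens_detour:
  assumes "lens u A v B h k" "distinct M" "set M \<inter> {u, v, h, k} = {}" "successively E (u # M @ [v])"
  shows "length M + 2 \<le> length A + length B"
  by (rule detour[OF _ lens_bridge[OF assms(1)]]) (use assms in \<open>auto simp: lens_def\<close>)

lemma lens_misses_two:
  assumes "lens u A v B h k"
    and "distinct M" "set M \<subseteq> set A \<union> set B" "successively E (u # M @ [v])"
    and "length A + length B \<le> length M + 2"
    and "set A \<union> set B \<subseteq> set M \<union> {x, y}" "\<not> E x y"
      "\<And>z. z \<notin> X \<Longrightarrow> \<not> E x z" "\<And>z. z \<notin> X \<Longrightarrow> \<not> E y z"
  shows False
  by (rule detour_misses_two[OF _ lens_bridge[OF assms(1)] _ _ _ assms(2-9), of h k])
    (use assms(1) in \<open>auto simp: lens_def\<close>)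

lemmas path_simps = successively_append_iff successively_Cons hd_append hd_rev last_rev

lemma lens_first_not_near:
  assumes L: "lens u A v B h k" shows "\<not> E (hd A) h"
proof -
  have "A \<noteq> []" using lens_lengths[OF L] by auto
  then show ?thesis
    using no_bypass[of u "[]" A v B "[h]"] L lens_edges[OF L] sym by (auto simp: lens_def)
qed

lemma lens_second_not_near:
  assumes L: "lens u (a1 # a2 # A) v B h k" shows "\<not> E a2 h"
proof -
  have "h \<noteq> k" using lens_edges[OF L] irrefl by metis
  then show ?thesis
    using no_bypass[of u "[a1]" "a2 # A" v B "[k, h]"] L lens_edges[OF L] sym by (auto simp: lens_def)
qed

lemma lens_not_near:
  assumes "lens u (a1 # a2 # A) v B h k" shows "\<not> E a1 h" "\<not> E a1 k" "\<not> E a2 h" "\<not> E a2 k"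
  using assms lens_flip lens_first_not_near lens_second_not_near by fastforce+

text \<open>
  Crossing from one arc to the other near \<open>u\<close> and \<open>v\<close>: the path runs back along \<open>B\<close> from \<open>u\<close>, jumps to \<open>A\<close> and
  follows it to \<open>v\<close>. It leaves out \<open>A0\<close> and \<open>B0\<close> only.
\<close>

lemma lens_cross:
  assumes L: "lens u (A0 @ A1) v (B0 @ B1) h k" and "A1 \<noteq> []" "B1 \<noteq> []" "length A0 + length B0 \<le> 1"
  shows "\<not> E (hd A1) (hd B1)"
proof
  assume e: "E (hd A1) (hd B1)"
  have "successively E (u # (rev B1 @ A1) @ [v])"
    using lens_edges[OF L] e assms(2,3) by (simp add: path_simps E_commute)
  then have "length (rev B1 @ A1) + 2 \<le> length (A0 @ A1) + length (B0 @ B1)"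
    by (intro lens_detour[OF L]) (use lens_X[OF L] lens_edges[OF L] in auto)
  then show False using assms(4) by simp
qed

text \<open>
  If \<open>v\<close> can be entered from the start of \<open>A\<close>, then \<open>A\<close> can be traversed backwards after \<open>B\<close>.
\<close>

lemma lens_chord:
  assumes L: "lens u (A0 @ A1 @ A2) v (B0 @ B1) h k" and "A1 \<noteq> []" "B1 \<noteq> []"
    and "length A0 + length A2 + length B0 \<le> 1" and "E (hd A1) v"
  shows "\<not> E (last A1) (hd B1)"
proof
  assume e: "E (last A1) (hd B1)"
  have "successively E (u # (rev B1 @ rev A1) @ [v])"
    using lens_edges[OF L] e assms(2,3,5) by (simp add: path_simps E_commute)
  then have "length (rev B1 @ rev A1) + 2 \<le> length (A0 @ A1 @ A2) + length (B0 @ B1)"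
    by (intro lens_detour[OF L]) (use lens_X[OF L] lens_edges[OF L] in auto)
  then show False using assms(4) by simp
qed

text \<open>
  The crossing of \<open>lens_cross\<close>, with a vertex \<open>z\<close> off the cycle as a stepping stone.
\<close>

lemma lens_outside_detour:
  assumes L: "lens u (A0 @ A1) v (B0 @ B1) h k" and "A1 \<noteq> []" "B1 \<noteq> []" "length A0 + length B0 \<le> 1"
    and z: "z \<notin> X" "z \<noteq> h" "z \<noteq> k" "E (hd A1) z"
  shows "\<not> E (hd B1) z"
proof
  assume e: "E (hd B1) z"
  have "successively E (u # (rev B1 @ z # A1) @ [v])"
    using lens_edges[OF L] e sym[OF z(4)] assms(2,3) by (simp add: path_simps)
  then have "length (rev B1 @ z # A1) + 2 \<le> length (A0 @ A1) + length (B0 @ B1)"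
    by (intro lens_detour[OF L]) (use lens_X[OF L] lens_edges[OF L] z in auto)
  then show False using assms(4) by simp
qed

text \<open>
  Otherwise \<open>v\<close> is the centre of a \<open>W\<^sup>*\<close> with triangles \<open>v b1 b2\<close> and \<open>v h k\<close>, whose pendant vertex is the
  last vertex of \<open>A\<close>.
\<close>

lemma lens_second_not_adjacent_if_chord:
  assumes L: "lens u A v (b1 # b2 # B) h k" and "E (hd A) v"
  shows "\<not> E v b2"
proof
  assume e: "E v b2"
  have "A \<noteq> []" using lens_lengths[OF L] by auto
  have "\<not> E (last A) b1" "\<not> E (last A) b2"
    using lens_chord[of u "[]" A "[]" v "[]" "b1 # b2 # B" h k]
      lens_chord[of u "[]" A "[]" v "[b1]" "b2 # B" h k] L assms(2) \<open>A \<noteq> []\<close> by auto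
  moreover have "\<not> E (last A) h" "\<not> E (last A) k"
    using lens_first_not_near[OF lens_turn[OF L]] lens_first_not_near[OF lens_turn[OF lens_flip[OF L]]]
      \<open>A \<noteq> []\<close> by (simp_all add: hd_rev)
  moreover have "E b1 b2" "E v b1" "E v (last A)" "E v h" "E v k" "E h k"
    using lens_edges[OF L] sym by auto
  ultimately show False
    using no_W[of v b1 b2 h k "last A"] e lens_not_near[OF lens_swap[OF L]] by blast
qed

text \<open>
  This makes the cycle neighbours of \<open>u\<close> and \<open>v\<close> safe to leave out of a detour. By the maximal
  length, a neighbour \<open>z\<close> of \<open>a1\<close> off the cycle is not adjacent to \<open>u\<close>, \<open>h\<close>, \<open>k\<close>, \<open>b1\<close>, \<open>b2\<close>, and each way the
  four vertices \<open>u\<close>, \<open>v\<close>, \<open>a1\<close>, \<open>b1\<close> can be joined then completes an induced \<open>P\<^sub>5\<close> or \<open>W\<^sup>*\<close>.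
\<close>

lemma lens_first_no_outside:
  assumes L: "lens u A v B h k" and "z \<notin> X"
  shows "\<not> E (hd A) z"
proof
  assume az: "E (hd A) z"
  obtain a1 a2 A' b1 b2 B' where AB: "A = a1 # a2 # A'" "B = b1 # b2 # B'"
    using lens_lengths[OF L] by (metis two_le_lengthE)
  note L = L[unfolded AB]
  note edges = lens_edges[OF L, simplified] and X = lens_X[OF L]
  note near = lens_not_near[OF L] lens_not_near[OF lens_swap[OF L]]
  have az: "E a1 z" using az AB by simp
  then have z: "z \<noteq> h" "z \<noteq> k" using near by auto
  have cut: "cut u (a1 # a2 # A') v (b1 # b2 # B')" using L by (simp add: lens_def)
  have zu: "\<not> E z u"
    using no_bypass[of u "[]" "a1 # a2 # A'" v _ "[z]"] cut az assms(2) sym by auto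
  have zhk: "\<not> E z x" if "x \<in> {h, k}" for x
    using no_bypass[of u "[]" "a1 # a2 # A'" v _ "[x, z]"] cut az assms(2) that z edges sym by auto
  have zb: "\<not> E z b1" "\<not> E z b2"
    using lens_outside_detour[of u "[]" "a1 # a2 # A'" v "[]" "b1 # b2 # B'" h k z]
      lens_outside_detour[of u "[]" "a1 # a2 # A'" v "[b1]" "b2 # B'" h k z]
      L az assms(2) z sym by auto
  have ab: "\<not> E a1 b1" "\<not> E a1 b2"
    using lens_cross[of u "[]" "a1 # a2 # A'" v "[]" "b1 # b2 # B'" h k]
      lens_cross[of u "[]" "a1 # a2 # A'" v "[b1]" "b2 # B'" h k] L by auto
  show False
  proof (cases "E a1 v")
    case True
    then have "\<not> E v b2" using lens_second_not_adjacent_if_chord[OF L] by simp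
    then have "E z v"
      using no_P5[of z a1 v b1 b2] az True edges ab zb sym by blast
    then show False
      using no_W[of v a1 z h k b1] True az edges near zhk ab zb sym by blast
  next
    case av: False
    show False
    proof (cases "E u b1")
      case True
      then have "E u b2" using no_P5[of z a1 u b1 b2] az edges ab zb zu sym by blast
      then show False using no_W[of u b1 b2 h k a1] True edges near ab sym by blast
    next
      case False
      then have "E u v" using no_P5[of a1 u h v b1] av edges near ab sym by blast
      then have "E z v" using no_P5[of z a1 u v b1] az av False edges zu ab zb sym by blast
      then have "\<not> E v b2" using no_W[of v b1 b2 h k z] edges near zhk zb sym by blast
      then show False using no_P5[of b2 b1 v z a1] \<open>E z v\<close> az av edges ab zb sym by blast
    qed
  qed
qed

lemma lens_last_no_outside:
  assumes "lens u A v B h k" and "z \<notin> X"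
  shows "\<not> E (last B) z" "\<not> E (last A) z" "\<not> E (hd B) z"
  using lens_first_no_outside[OF lens_reflect[OF assms(1)] assms(2)]
    lens_first_no_outside[OF lens_turn[OF assms(1)] assms(2)]
    lens_first_no_outside[OF lens_swap[OF assms(1)] assms(2)] lens_lengths[OF assms(1)]
  by (simp_all add: hd_rev)

lemma lens_not_near_last:
  assumes "lens u A v B h k" "rev A = x1 # x2 # A'"
  shows "\<not> E x1 h" "\<not> E x1 k" "\<not> E x2 h" "\<not> E x2 k"
  using lens_not_near[of v x1 x2 A' u "rev B" h k] lens_turn[OF assms(1)] assms(2) by auto

text \<open>
  A chord from the start of \<open>A\<close> to \<open>v\<close> forces the second vertices \<open>x2\<close> and \<open>b2\<close> on either side of \<open>v\<close> to be
  nonadjacent to \<open>v\<close>. In the path \<open>x2 x1 v b1 b2\<close> the only remaining chord is \<open>x2 b2\<close>; with it the detour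
  through both arcs leaves out \<open>x1\<close> and \<open>b1\<close>, which are nonadjacent.
\<close>

lemma lens_no_chord:
  assumes L: "lens u A v B h k"
  shows "\<not> E (hd A) v"
proof
  assume chord: "E (hd A) v"
  obtain x1 x2 A' b1 b2 B' where AB: "rev A = x1 # x2 # A'" "B = b1 # b2 # B'"
    using lens_lengths[OF L] by (metis two_le_lengthE length_rev)
  then have A: "A = (rev A' @ [x2]) @ [x1]" by (simp add: rev_swap)
  have A1: "E (last (x2 # A')) v" "E (hd (rev A' @ [x2])) v"
    using chord by (simp_all add: A hd_append hd_rev split: if_splits)
  note no_outside = lens_last_no_outside[OF L, unfolded A AB(2), simplified]
  have b2: "\<not> E v b2" using lens_second_not_adjacent_if_chord L chord AB(2) by blast
  note near = lens_not_near_last[OF L AB(1)] lens_not_near[OF lens_swap[OF L[unfolded AB(2)]]]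
  note L = L[unfolded A AB(2)]
  note edges = lens_edges[OF L, simplified] and X = lens_X[OF L]
  have xb: "\<not> E x1 b1" "\<not> E x1 b2" "\<not> E x2 b1"
    using lens_chord[of u "[]" "(rev A' @ [x2]) @ [x1]" "[]" v "[]" "b1 # b2 # B'" h k]
      lens_chord[of u "[]" "(rev A' @ [x2]) @ [x1]" "[]" v "[b1]" "b2 # B'" h k]
      lens_chord[of u "[]" "rev A' @ [x2]" "[x1]" v "[]" "b1 # b2 # B'" h k]
      L A1 by (simp_all add: hd_append split: if_splits)
  have e: "E x2 x1" "E x1 v" "E v b1" "E b1 b2" "successively E (x2 # A')" "E (last (b2 # B')) u"
      "successively E (b2 # B')"
    using edges successively_rev_E[of "x2 # A'"] by (simp_all add: path_simps E_commute)
  have "\<not> E v x2" using no_W[of v x1 x2 h k b1] e edges near xb sym by blast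
  then have "E x2 b2" using no_P5[of x2 x1 v b1 b2] e xb b2 sym by blast
  then have "successively E (u # (rev (b2 # B') @ x2 # A') @ [v])"
    using e A1 by (auto simp: path_simps E_commute)
  then show False
    by (rule lens_misses_two[OF L, rotated 2, of _ x1 b1])
      (use X no_outside xb in auto)
qed

text \<open>
  Both possible chords at \<open>b2\<close> are excluded, \<open>a2 b2\<close> by the detour leaving out \<open>a1\<close> and \<open>b1\<close>, and \<open>v b2\<close>
  by a \<open>W\<^sup>*\<close> centred at \<open>v\<close>; so \<open>a1 a2 v b1 b2\<close> would be induced.
\<close>

lemma lens_second_not_opposite:
  assumes L: "lens u (a1 # a2 # A) v B h k"
  shows "\<not> E a2 v"
proof
  assume e: "E a2 v"
  obtain b1 b2 B' where B: "B = b1 # b2 # B'"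
    using lens_lengths[OF L] by (metis two_le_lengthE)
  note L = L[unfolded B]
  note edges = lens_edges[OF L, simplified] and X = lens_X[OF L]
  note near = lens_not_near[OF L] lens_not_near[OF lens_swap[OF L]]
  note no_outside = lens_first_no_outside[OF L, simplified] lens_last_no_outside[OF L, simplified]
  have ab: "\<not> E a1 b1" "\<not> E a1 b2" "\<not> E a2 b1"
    using lens_cross[of u "[]" "a1 # a2 # A" v "[]" "b1 # b2 # B'" h k]
      lens_cross[of u "[]" "a1 # a2 # A" v "[b1]" "b2 # B'" h k]
      lens_cross[of u "[a1]" "a2 # A" v "[]" "b1 # b2 # B'" h k] L by auto
  have "\<not> E a2 b2"
  proof
    assume "E a2 b2"
    then have "successively E (u # (rev (b2 # B') @ a2 # A) @ [v])"
      using edges by (auto simp: path_simps E_commute)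
    then show False
      by (rule lens_misses_two[OF L, rotated 2, of _ a1 b1]) (use X no_outside ab in auto)
  qed
  moreover from this have "\<not> E v b2" using no_W[of v b1 b2 h k a2] e edges near ab sym by blast
  ultimately show False
    using no_P5[of a1 a2 v b1 b2] e lens_no_chord[OF L] edges ab sym by auto
qed

lemma lens_ends_adjacent:
  assumes L: "lens u A v B h k" shows "E u v"
proof -
  have "A \<noteq> []" "B \<noteq> []" using lens_lengths[OF L] by auto
  then have "\<not> E (hd A) (hd B)" using lens_cross[of u "[]" A v "[]" B h k] L by simp
  then show ?thesis
    using no_P5[of "hd A" u h v "hd B"] lens_edges[OF L] lens_no_chord[OF L]
      lens_no_chord[OF lens_swap[OF L]] lens_first_not_near[OF L]
      lens_first_not_near[OF lens_swap[OF L]] sym by blast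
qed

lemma lens_second_adjacent:
  assumes L: "lens u (a1 # a2 # A) v B h k" shows "E u a2"
proof -
  have "B \<noteq> []" using lens_lengths[OF L] by auto
  then have "\<not> E a1 (hd B)" "\<not> E a2 (hd B)"
    using lens_cross[of u "[]" "a1 # a2 # A" v "[]" B h k]
      lens_cross[of u "[a1]" "a2 # A" v "[]" B h k] L by auto
  then show ?thesis
    using no_P5[of a2 a1 u v "hd B"] lens_edges[OF L, simplified] lens_no_chord[OF L]
      lens_no_chord[OF lens_swap[OF L]] lens_second_not_opposite[OF L] lens_ends_adjacent[OF L] sym
    by auto
qed

text \<open>
  Otherwise \<open>u y1 y2\<close>, \<open>u h k\<close> and the pendant vertex \<open>hd A\<close> form a \<open>W\<^sup>*\<close> centred at \<open>u\<close>. The point is that a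
  path can pass from one side of \<open>u\<close> to the other without using \<open>u\<close>, at the cost of at most one vertex.
\<close>

lemma lens_across:
  assumes L: "lens u A v B h k" and B: "rev B = y1 # y2 # B'"
  shows "E y1 (hd A) \<or> E y2 (hd A)"
proof -
  note R = lens_reflect[OF L, unfolded B]
  show ?thesis
    using no_W[of u y1 y2 h k "hd A"] lens_edges[OF R, simplified] lens_edges[OF L] lens_not_near[OF R]
      lens_first_not_near[OF L] lens_first_not_near[OF lens_flip[OF L]] lens_second_adjacent[OF R] sym
    by blast
qed

text \<open>
  Thus a final segment \<open>M\<close> of \<open>B\<close> that \<open>u\<close> can enter at its start can be traversed from \<open>u\<close> to the start of
  \<open>A\<close>, leaving out at most the last vertex of \<open>B\<close>.
\<close>

lemma lens_through_end:
  assumes L: "lens u A v (N @ M) h k" and M: "M \<noteq> []" "E u (hd M)"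
  obtains M' where "M' = M \<or> M' = butlast M" "successively E (u # M' @ [hd A])"
proof (cases "length M = 1")
  case True
  then have "butlast M = []" by (cases M) auto
  then show ?thesis using that[of "butlast M"] lens_edges[OF L] by simp
next
  case False
  then obtain y1 y2 M0 where "rev M = y1 # y2 # M0"
    using M by (metis two_le_lengthE length_rev length_0_conv less_2_cases not_le One_nat_def)
  then have r: "rev (N @ M) = y1 # y2 # (M0 @ rev N)" and M': "M = rev M0 @ [y2, y1]"
    by (simp_all add: rev_swap)
  note e = lens_edges(6)[OF L, unfolded M']
  from lens_across[OF L r] show ?thesis
  proof
    assume "E y1 (hd A)"
    then have "successively E (u # M @ [hd A])" using e M by (auto simp: M' path_simps)
    then show ?thesis using that by blast
  next
    assume "E y2 (hd A)"
    then have "successively E (u # butlast M @ [hd A])"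
      using e M by (auto simp: M' path_simps butlast_append)
    then show ?thesis using that by blast
  qed
qed

lemma set_subset_butlast: "set xs \<subseteq> insert (last xs) (set (butlast xs))"
  by (induction xs) auto

text \<open>
  Go from \<open>u\<close> into the final segment \<open>M\<close> of \<open>B\<close>, pass by \<open>u\<close> into \<open>A\<close>, pass by \<open>v\<close> into the initial segment
  \<open>N\<close> of \<open>B\<close> and return to \<open>v\<close>. The first pass loses at most \<open>last B\<close>, the second at most \<open>last A\<close>, and these
  two are nonadjacent without neighbours off the cycle.
\<close>

lemma lens_no_switch:
  assumes L: "lens u A v (N @ M) h k" and "N \<noteq> []" "M \<noteq> []"
  shows "\<not> (E (last N) v \<and> E u (hd M))"
proof
  assume switch: "E (last N) v \<and> E u (hd M)"
  with L assms(3) obtain M' where M': "M' = M \<or> M' = butlast M" "successively E (u # M' @ [hd A])"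
    by (elim lens_through_end) auto
  obtain x1 x2 A0 where "rev A = x1 # x2 # A0"
    using lens_lengths[OF L] by (metis two_le_lengthE length_rev)
  then have A0: "A = rev A0 @ [x2, x1]" by (simp add: rev_swap)
  have "E x1 (hd (N @ M)) \<or> E x2 (hd (N @ M))"
    by (rule lens_across[OF lens_swap[OF L]]) fact
  then obtain A' where A': "A' = A \<or> A' = butlast A" "A' \<noteq> []" "hd A' = hd A" "successively E A'"
      "E (last A') (hd N)"
  proof
    assume "E x1 (hd (N @ M))"
    then show thesis using that[of A] lens_edges(3)[OF L] assms(2) by (simp add: A0)
  next
    assume e: "E x2 (hd (N @ M))"
    have "butlast A = rev A0 @ [x2]" by (simp add: A0 butlast_append)
    moreover have "successively E (rev A0 @ [x2])"
      using lens_edges(3)[OF L] by (simp add: A0 successively_append_iff)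
    ultimately show thesis using that[of "butlast A"] e assms(2) by (simp add: A0 hd_append)
  qed
  have "successively E (u # (M' @ A' @ N) @ [v])"
    using M' A' switch lens_edges(6)[OF L] assms(2) by (auto simp: path_simps)
  then show False
  proof (rule lens_misses_two[OF L, rotated 2])
    show "distinct (M' @ A' @ N)" "set (M' @ A' @ N) \<subseteq> set A \<union> set (N @ M)"
      using lens_X(2)[OF L] M'(1) A'(1) by (auto simp: distinct_butlast dest!: in_set_butlastD)
    show "length A + length (N @ M) \<le> length (M' @ A' @ N) + 2"
      using M'(1) A'(1) by auto
    show "set A \<union> set (N @ M) \<subseteq> set (M' @ A' @ N) \<union> {last A, last M}"
      using M'(1) A'(1) set_subset_butlast by fastforce
    show "\<not> E (last A) (last M)"
      using lens_cross[of u "[]" "rev (N @ M)" v "[]" "rev A" h k] lens_reflect[OF L] assms(3) A0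
      by (auto simp: hd_rev E_commute)
    fix z assume "z \<notin> X"
    from lens_last_no_outside[OF L this] show "\<not> E (last A) z" "\<not> E (last M) z"
      using assms(3) by auto
  qed
qed

text \<open>
  Going back along \<open>B\<close> from \<open>u\<close>, let \<open>c\<close> be the first vertex that is not of the kind "adjacent to \<open>u\<close> but not
  to \<open>v\<close>", and \<open>d\<close> the vertex before it on this way. If \<open>c\<close> is adjacent to \<open>v\<close>, there is a switch from \<open>c\<close>
  to \<open>d\<close>. Otherwise \<open>c\<close> is adjacent to neither, and \<open>c d u v\<close> extends by the last vertex of \<open>A\<close> to a path
  whose only possible chords, from that vertex to \<open>c\<close> or \<open>d\<close>, yield detours.
\<close>

theorem no_lens: "\<not> lens u A v B h k"
proof
  assume L: "lens u A v B h k"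
  let ?Q = "\<lambda>x. E u x \<and> \<not> E x v"
  have "B \<noteq> []" "A \<noteq> []" using lens_lengths[OF L] by auto
  then have "hd B \<in> set B" "\<not> ?Q (hd B)" using lens_edges[OF L] sym by auto
  then obtain N c M where B: "B = N @ c # M" and c: "\<not> ?Q c" and M: "\<And>x. x \<in> set M \<Longrightarrow> ?Q x"
    using split_list_last_prop[of B "\<lambda>x. \<not> ?Q x"] by blast
  obtain y1 y2 B' where B': "rev B = y1 # y2 # B'"
    using lens_lengths[OF L] by (metis two_le_lengthE length_rev)
  note R = lens_reflect[OF L, unfolded B']
  have y: "?Q y1" "?Q y2"
    using lens_edges[OF R] lens_second_adjacent[OF R] lens_no_chord[OF R] lens_second_not_opposite[OF R]
    by auto
  \<comment> \<open>The last two vertices of \<open>B\<close> satisfy \<open>?Q\<close>, so a vertex \<open>e\<close> is left after \<open>d\<close> through which a detour can start.\<close>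
  obtain d e M0 where M0: "M = d # e # M0"
  proof -
    have "rev B = rev M @ c # rev N" using B by simp
    then have "2 \<le> length (rev M)"
      using B' y c by (cases "rev M"; cases "tl (rev M)") auto
    then show thesis using that by (auto elim: two_le_lengthE)
  qed
  have d: "E u d" "\<not> E d v" "E u e" using M M0 by auto
  have "\<not> E c v"
    using lens_no_switch[of u A v "N @ [c]" M h k] L B M0 d by auto
  with c have cu: "\<not> E u c" by simp
  have xv: "E (last A) v" "\<not> E (last A) u"
    using lens_edges[OF L] lens_no_chord[OF lens_turn[OF L]] \<open>A \<noteq> []\<close> by (auto simp: hd_rev)
  have cd: "E c d" "successively E (N @ [c, d])"
    using lens_edges(6)[OF L] by (auto simp: B M0 path_simps)
  \<comment> \<open>From \<open>u\<close> through the rest \<open>M2\<close> of \<open>B\<close> into \<open>A\<close>, then by the chord to \<open>last A\<close> back along \<open>B\<close> to \<open>v\<close>.\<close>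
  have no_detour: False
    if "M = M1 @ M2" "M2 \<noteq> []" "E u (hd M2)" "E (last (c # M1)) (last A)" for M1 M2
  proof -
    have "B = (N @ c # M1) @ M2" using B that by simp
    with L that obtain M' where M': "M' = M2 \<or> M' = butlast M2" "successively E (u # M' @ [hd A])"
      by (metis lens_through_end)
    have "successively E (u # (M' @ A @ rev (N @ c # M1)) @ [v])"
      using M' lens_edges[OF L] that \<open>A \<noteq> []\<close>
      by (auto simp: B path_simps E_commute)
    then have "length (M' @ A @ rev (N @ c # M1)) + 2 \<le> length A + length B"
      by (intro lens_detour[OF L])
        (use M'(1) lens_X[OF L] lens_edges[OF L] that(1) B in
          \<open>auto simp: distinct_butlast dest!: in_set_butlastD\<close>)
    then show False using M'(1) that(1,2) B by auto
  qed
  have "E c (last A) \<or> E d (last A)"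
    using no_P5[of c d u v "last A"] cd d cu \<open>\<not> E c v\<close> xv lens_ends_adjacent[OF L] sym by blast
  then show False
    using no_detour[of "[]" M] no_detour[of "[d]" "e # M0"] M0 d by auto
qed

section \<open>Attachment to part of a component\<close>

text \<open>
  Throughout, \<open>u\<close> is adjacent to \<open>h\<close> but not to its neighbour \<open>k\<close>, both off the cycle. A further neighbour \<open>z\<close>
  would start the induced path \<open>z a1 u h k\<close>, where \<open>a1\<close> is the first vertex of \<open>A\<close>: each chord of it is the
  shortcut of a bypass.
\<close>

lemma mixed_first_no_outside:
  assumes cut: "cut u A v B" "A \<noteq> []" and hk: "h \<notin> X" "k \<notin> X" "E u h" "E h k" "\<not> E u k"
    and z: "z \<notin> X"
  shows "\<not> E (hd A) z"
proof
  assume e: "E (hd A) z"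
  note bypass = no_bypass[of u "[]" A v B, simplified, OF cut]
  have far: "\<not> E (hd A) h" "\<not> E (hd A) k"
    using bypass[of "[h]"] bypass[of "[h, k]"] hk by (auto simp: E_commute[of "hd A"])
  then have "z \<noteq> h" "z \<noteq> k" using e by auto
  then have "\<not> E u z" "\<not> E z h" "\<not> E z k"
    using bypass[of "[z]"] bypass[of "[h, z]"] bypass[of "[h, k, z]"] z hk sym[OF e]
    by (auto simp: E_commute[of z])
  moreover have "E u (hd A)"
    using cut_edges(1)[OF cut(1)] cut(2) by (simp add: successively_Cons)
  ultimately show False using no_P5[of z "hd A" u h k] e far hk sym by blast
qed

text \<open>
  The path \<open>a2 a1 u h k\<close> must have a chord. If it were \<open>a2 h\<close>, then \<open>h\<close> could be exchanged for \<open>a1\<close>, whose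
  neighbours all lie on the cycle; \<open>a2 k\<close> would give a longer cycle.
\<close>

lemma mixed_second_adjacent:
  assumes cut: "cut u (a1 # a2 # A) v B" and hk: "h \<notin> X" "k \<notin> X" "E u h" "E h k" "\<not> E u k"
  shows "\<not> E a2 h" "E u a2"
proof -
  note no_outside = mixed_first_no_outside[OF cut _ hk, simplified]
  show far: "\<not> E a2 h"
  proof
    assume "E a2 h"
    then have "E h a2" by (rule sym)
    then have c: "cyc (u # h # (a2 # A) @ v # B)"
      using cut hk by (auto simp: cut_def cyc_def)
    have X: "X - set (u # h # (a2 # A) @ v # B) \<subseteq> {a1}"
      using cut by (auto simp: cut_def)
    show False
    proof (rule no_exchange[OF c _ _ _ hk(2), THEN notE])
      show "length (u # h # (a2 # A) @ v # B) = card X" using card_cut[OF cut] by simp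
      show "h \<in> set (u # h # (a2 # A) @ v # B) - X" using hk by simp
      fix x y assume x: "x \<in> X - set (u # h # (a2 # A) @ v # B)" "E x y"
      then have "x = a1" using X by blast
      then have "y \<in> X" "y \<noteq> a1" using x(2) no_outside irrefl by blast+
      then show "y \<in> set (u # h # (a2 # A) @ v # B)" using cut by (auto simp: cut_def)
    qed (rule hk)
  qed
  have "\<not> E a2 k"
    using no_bypass[of u "[a1]" "a2 # A" v B "[h, k]"] cut hk E_commute[of a2 k] by auto
  moreover have "E u a1" "E a1 a2" using cut_edges(1)[OF cut] by auto
  ultimately show "E u a2"
    using no_P5[of a2 a1 u h k] far hk no_outside sym by blast
qed

text \<open>
  Since \<open>u\<close> is adjacent to all of \<open>A\<close>, in particular to its last vertex, \<open>A\<close> can be traversed backwards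
  from \<open>u\<close>, and then \<open>B\<close> backwards to \<open>v\<close>. Hence none of the pairs \<open>a1 y1\<close>, \<open>a1 y2\<close>, \<open>a2 y1\<close> on the two sides
  of \<open>u\<close> is adjacent, and the \<open>W\<^sup>*\<close> with triangles \<open>u a1 a2\<close>, \<open>u y1 y2\<close> and pendant vertex \<open>h\<close> forces the
  edge \<open>a2 y2\<close>. The path over this edge leaves out just \<open>a1\<close> and \<open>y1\<close>.
\<close>

lemma no_mixed_attachment:
  assumes cut: "cut u A v B" and bridge: "bridge u P v"
    and hk: "h \<notin> X" "k \<notin> X" "E u h" "E h k" "\<not> E u k"
    and far: "\<And>a. a \<in> set A \<Longrightarrow> \<not> E a h \<and> \<not> E a k"
  shows False
proof -
  have "2 \<le> length A" "2 \<le> length (rev B)" using arc_length[OF cut bridge] by auto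
  then obtain a1 a2 A' y1 y2 B' where A: "A = a1 # a2 # A'" and B: "rev B = y1 # y2 # B'"
    by (metis two_le_lengthE)
  then have AB: "A \<noteq> []" "B \<noteq> []" and B'': "B = rev B' @ [y2, y1]" by (auto simp: rev_swap)
  note edges = arc_edges[OF cut AB]
  have R: "cut u (y1 # y2 # B') v (rev A)" using cut_reflect[OF cut] B by simp
  \<comment> \<open>At the first vertex of \<open>A\<close> that is not adjacent to \<open>u\<close> an induced \<open>P\<^sub>5\<close> would begin.\<close>
  have uA: "E u a" if "a \<in> set A" for a
  proof (rule ccontr)
    assume "\<not> E u a"
    with that obtain N c M where A': "A = N @ c # M" and c: "\<not> E u c" and N: "\<forall>x\<in>set N. E u x"
      using split_list_first_prop[of A "\<lambda>x. \<not> E u x"] by blast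
    have "N \<noteq> []" using A' c edges(1) by auto
    then have "E u (last N)" "E c (last N)" "last N \<in> set A" "c \<in> set A"
      using N edges(3) A' by (auto simp: path_simps E_commute)
    then show False using no_P5[of c "last N" u h k] far c hk sym by blast
  qed
  have uy: "E u y2" "\<not> E y2 h" using mixed_second_adjacent[OF R hk] by auto
  have no_outside: "\<not> E a1 z" "\<not> E y1 z" if "z \<notin> X" for z
    using mixed_first_no_outside[OF cut AB(1) hk that] mixed_first_no_outside[OF R _ hk that] A by auto
  have sy: "successively E (y1 # y2 # B')"
    using edges(6) successively_rev_E[of B] by (simp add: B)
  have lasty: "E (last (y1 # y2 # B')) v"
    using edges(4) AB(2) last_rev[of B] by (simp only: B E_commute[of v])
  have y: "E u y1" "E y1 y2"
    using edges(5) sy by (simp_all add: B'')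
  have X: "X = {u, v} \<union> set A \<union> set B" and d: "distinct (u # A @ v # B)"
    using cut by (auto simp: cut_def cyc_def)
  have P: "set P \<inter> X = {}" using bridge by (simp add: bridge_def)
  have no_detour: False
    if "A = A0 @ A1" "y1 # y2 # B' = B0 @ B1" "A1 \<noteq> []" "B1 \<noteq> []"
      "length A0 + length B0 \<le> 1" "E (hd A1) (hd B1)" for A0 A1 B0 B1
  proof -
    have B1: "B = rev B1 @ rev B0" using that(2) B by (metis rev_append rev_rev_ident)
    have "successively E (B0 @ B1)" "E (last (B0 @ B1)) v" using sy lasty that(2) by simp_all
    moreover have "successively E (A0 @ A1)" "E u (last A1)" using edges(3) uA that by simp_all
    ultimately have "successively E (u # (rev A1 @ B1) @ [v])"
      using that(3,4,6) by (simp add: path_simps)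
    then have "length (rev A1 @ B1) + 2 \<le> length A + length B"
      by (intro detour[OF cut bridge]) (use d P X in \<open>auto simp: that(1) B1\<close>)
    then show False using that(5) by (simp add: that(1) B1)
  qed
  have ay: "\<not> E a1 y1" "\<not> E a1 y2" "\<not> E a2 y1"
    using no_detour[of "[]" A "[]" "y1 # y2 # B'"] no_detour[of "[]" A "[y1]" "y2 # B'"]
      no_detour[of "[a1]" "a2 # A'" "[]" "y1 # y2 # B'"] A by auto
  have "\<not> E y1 h" using no_outside hk by blast
  moreover have "E a1 a2" "E u a1" "E u a2" "\<not> E a1 h" "\<not> E a2 h" using edges(3) uA far A by auto
  ultimately have "E a2 y2" using no_W[of u a1 a2 y1 y2 h] uy y ay hk sym by blast
  then have "successively E (u # (rev (a2 # A') @ y2 # B') @ [v])"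
    using uA[of "last A"] edges(3) sy lasty by (auto simp: A path_simps E_commute[of "hd A'"])
  moreover obtain p q P' where "P = p # q # P'"
    using bridge two_le_lengthE[of P] by (auto simp: bridge_def)
  then have "p \<in> set P" "E p q" "q \<notin> X" using bridge P by (auto simp: bridge_def)
  ultimately show False
    by (intro detour_misses_two[OF cut bridge, of p q "rev (a2 # A') @ y2 # B'" a1 y1])
      (use d ay no_outside in \<open>auto simp: A B''\<close>)
qed

end

section \<open>Components off the cycle\<close>

lemma rtranclp_distinct_path:
  assumes "R\<^sup>*\<^sup>* x y"
  obtains P where "P \<noteq> []" "hd P = x" "last P = y" "distinct P" "successively R P"
  using assms
proof (induction arbitrary: thesis rule: rtranclp_induct)
  case base
  show ?case by (rule base[of "[x]"]) auto
next
  case (step y z)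
  obtain P where P: "P \<noteq> []" "hd P = x" "last P = y" "distinct P" "successively R P"
    by (rule step.IH)
  show ?case
  proof (cases "z \<in> set P")
    case True
    then obtain P1 P2 where "P = P1 @ z # P2" by (meson split_list)
    then show ?thesis
      using step.prems[of "P1 @ [z]"] P by (auto simp: successively_append_iff hd_append)
  next
    case False
    then show ?thesis
      using step.prems[of "P @ [z]"] step.hyps P by (simp add: successively_append_iff)
  qed
qed

context extremal_cycle
begin

definition linked :: "'a \<Rightarrow> 'a \<Rightarrow> bool" where
  "linked = (\<lambda>x y. E x y \<and> x \<notin> X \<and> y \<notin> X)\<^sup>*\<^sup>*"

lemma linked_sym: "linked x y \<Longrightarrow> linked y x"
  unfolding linked_def
  by (induction rule: rtranclp_induct) (auto intro: converse_rtranclp_into_rtranclp sym)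

lemma linked_trans: "linked x y \<Longrightarrow> linked y z \<Longrightarrow> linked x z"
  unfolding linked_def by (rule rtranclp_trans)

lemma linked_outside: "linked x y \<Longrightarrow> x \<notin> X \<Longrightarrow> y \<notin> X"
  unfolding linked_def by (induction rule: rtranclp_induct) auto

text \<open>
  Disjoint edges to the cycle give a path through the component with at least two inner vertices.
\<close>

lemma linked_bridge:
  assumes "linked h k" "h \<noteq> k" "h \<notin> X" "E u h" "E v k"
  obtains P where "bridge u P v"
proof -
  obtain P where P: "P \<noteq> []" "hd P = h" "last P = k" "distinct P"
      "successively (\<lambda>x y. E x y \<and> x \<notin> X \<and> y \<notin> X) P"
    using assms(1) unfolding linked_def by (rule rtranclp_distinct_path)
  obtain q P' where PP: "P = h # q # P'"
    using P(1-3) assms(2) by (cases P; cases "tl P") auto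
  have s: "successively E P" by (rule successively_mono[OF P(5)]) auto
  have "z \<notin> X"
    if "successively (\<lambda>x y. E x y \<and> x \<notin> X \<and> y \<notin> X) (p # Q)" "p \<notin> X" "z \<in> set (p # Q)" for z Q p
    using that by (induction Q arbitrary: p) auto
  from this[of h "q # P'"] have "set P \<inter> X = {}"
    using P(5) assms(3) unfolding PP by blast
  then have "bridge u P v"
    using P s assms(4,5) PP sym[OF assms(5)]
    by (auto simp add: bridge_def path_simps)
  then show ?thesis by (rule that)
qed

text \<open>
  A vertex adjacent to a part of a component distinguishes the ends of some edge of the component.
\<close>

lemma linked_mixed_edge:
  assumes "linked h k" "h \<notin> X" "E u h" "\<not> E u k"
  obtains h' k' where "linked h h'" "linked h k'" "E h' k'" "E u h'" "\<not> E u k'"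
proof -
  have "E u k \<or> (\<exists>h' k'. linked h h' \<and> linked h k' \<and> E h' k' \<and> E u h' \<and> \<not> E u k')"
    using assms(1) unfolding linked_def
  proof (induction rule: rtranclp_induct)
    case base
    show ?case using assms(3) by simp
  next
    case (step y z)
    have "(\<lambda>x y. E x y \<and> x \<notin> X \<and> y \<notin> X)\<^sup>*\<^sup>* h z"
      using step.hyps by (rule rtranclp.rtrancl_into_rtrancl)
    then show ?case using step by blast
  qed
  then show ?thesis using that assms(4) by blast
qed

lemma cut_exists:
  assumes C: "cyc C" "set C = X" and "u \<in> X" "v \<in> X" "u \<noteq> v"
  obtains A B where "cut u A v B"
proof -
  obtain C1 C2 where C12: "C = C1 @ u # C2" using assms split_list[of u C] by auto
  then have c: "cyc (u # C2 @ C1)" using cyc_append_commute[of C1 "u # C2"] C by simp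
  have "v \<in> set (C2 @ C1)" using C12 assms by auto
  then obtain A B where "C2 @ C1 = A @ v # B" by (meson split_list)
  moreover have "set (u # C2 @ C1) = X" using C(2) C12 by auto
  ultimately have "cut u A v B" using c by (simp only: cut_def)
  then show ?thesis by (rule that)
qed

text \<open>
  Of all pairs of disjoint edges \<open>uh\<close>, \<open>vk\<close> from the component of \<open>x\<close> to the cycle, together with a direction
  of the cycle, take one with the arc from \<open>u\<close> to \<open>v\<close> shortest. An inner vertex of this arc with a neighbour
  \<open>l\<close> in the component would form a better pair with \<open>uh\<close> if \<open>l \<noteq> h\<close>, and with \<open>vk\<close> if \<open>l = h\<close>. So neither \<open>u\<close> nor
  \<open>v\<close> can be adjacent to a part of the component only, and every edge of the component gives a lens.
\<close>

theorem no_edge_outside: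
  assumes C: "cyc C" "set C = X" and xy: "E x y" "x \<notin> X" "y \<notin> X"
    and attached: "u0 \<in> X" "v0 \<in> X" "u0 \<noteq> v0" "linked x h0" "linked x k0" "h0 \<noteq> k0" "E u0 h0" "E v0 k0"
  shows False
proof -
  let ?P = "\<lambda>(u, A, v, B, h, k). cut u A v B \<and> linked x h \<and> linked x k \<and> h \<noteq> k \<and> E u h \<and> E v k"
  obtain A0 B0 where "cut u0 A0 v0 B0" using cut_exists C attached by blast
  then have "?P (u0, A0, v0, B0, h0, k0)" using attached by simp
  from ex_has_least_nat[of ?P, OF this, of "\<lambda>(u, A, v, B, h, k). length A"]
  obtain t where t: "?P t" "\<And>s. ?P s \<Longrightarrow> (\<lambda>(u, A, v, B, h, k). length A) t \<le> (\<lambda>(u, A, v, B, h, k). length A) s"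
    by blast
  obtain u A v B h k where "t = (u, A, v, B, h, k)" by (cases t) auto
  with t(1) have cut: "cut u A v B" and hk: "linked x h" "linked x k" "h \<noteq> k" "E u h" "E v k"
    by simp_all
  have least: "length A \<le> length A'"
    if "cut u' A' v' B'" "linked x h'" "linked x k'" "h' \<noteq> k'" "E u' h'" "E v' k'" for u' A' v' B' h' k'
    using t(2)[of "(u', A', v', B', h', k')"] that \<open>t = _\<close> by simp
  have far: "\<not> E w l" if w: "w \<in> set A" "linked x l" for w l
  proof
    assume wl: "E w l"
    obtain A1 A2 where A: "A = A1 @ w # A2" using w(1) by (meson split_list)
    have "cut u A1 w (A2 @ v # B)" using cut by (simp add: A cut_def)
    then have "\<not> h \<noteq> l" using least[of u A1 w "A2 @ v # B" h l] hk wl w(2) A by auto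
    moreover have "cut w A2 v (B @ u # A1)"
      using cut cyc_append_commute[of "u # A1" "w # A2 @ v # B"] by (auto simp: A cut_def)
    ultimately show False using least[of w A2 v "B @ u # A1" l k] hk wl w(2) A by auto
  qed
  have out: "h' \<notin> X" if "linked x h'" for h' using linked_outside that xy by blast
  have hk': "linked h k" using hk linked_sym linked_trans by blast
  obtain P where P: "bridge u P v" using linked_bridge hk' hk out by blast
  have complete: "E u l"
    if a: "cut u A v B" "bridge u P v" "linked x h" "E u h" "\<And>w l. w \<in> set A \<Longrightarrow> linked x l \<Longrightarrow> \<not> E w l" "linked x l"
    for u A v B P h l
  proof (rule ccontr)
    assume "\<not> E u l"
    moreover have "linked h l" using a linked_sym linked_trans by blast
    ultimately obtain h' k' where "linked h h'" "linked h k'" "E h' k'" "E u h'" "\<not> E u k'"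
      using linked_mixed_edge[of h l u] out a(3,4) by blast
    then show False
      using no_mixed_attachment[OF a(1,2), of h' k'] out a(3,5) linked_trans by blast
  qed
  have l: "linked x x" "linked x y" using xy by (auto simp: linked_def)
  have "E u l" if "linked x l" for l
    by (rule complete[OF cut P hk(1,4) _ that]) (rule far)
  moreover have "E v l" if "linked x l" for l
    by (rule complete[OF cut_swap[OF cut_reflect[OF cut]] bridge_rev[OF P] hk(2,5) _ that]) (simp add: far)
  ultimately have "lens u A v B x y" using l cut xy by (simp add: lens_def)
  then show False by (simp add: no_lens)
qed

end

section \<open>Two-connected graphs\<close>

text \<open>
  2-connectivity in terms of edge cuts: no set of vertices is separated from the others once one vertex
  \<open>w\<close> is deleted. Allowing \<open>w\<close> outside \<open>V\<close> includes the connectivity of the whole graph.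
\<close>

locale two_connected = sym_rel +
  fixes V :: "'a set"
  assumes finite_V: "finite V" and card_V: "2 < card V"
    and E_in_V: "E x y \<Longrightarrow> x \<in> V"
    and crossing: "\<lbrakk>S \<subseteq> V - {w}; S \<noteq> {}; S \<noteq> V - {w}\<rbrakk> \<Longrightarrow> \<exists>x\<in>S. \<exists>y\<in>V - {w} - S. E x y"
begin

lemma cyc_subset_V: "cyc xs \<Longrightarrow> set xs \<subseteq> V"
proof -
  assume c: "cyc xs"
  then obtain a b ys where xs: "xs = a # b # ys"
    by (auto simp: cyc_def Suc_le_length_iff numeral_3_eq_3)
  have "set (a # zs) \<subseteq> V" if "successively E (a # zs)" "a \<in> V" for a zs
    using that by (induction zs arbitrary: a) (use E_in_V sym in \<open>auto, blast+\<close>)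
  from this[of a "b # ys"] show ?thesis using c E_in_V[of a b] by (simp add: cyc_def xs)
qed

lemma length_cyc_le: "cyc xs \<Longrightarrow> length xs \<le> card V"
  using cyc_subset_V card_mono[OF finite_V] distinct_card unfolding cyc_def by metis

text \<open>
  From one edge between \<open>X\<close> and \<open>H\<close>, deleting its end in \<open>X\<close> gives an edge with another end in \<open>X\<close>, and
  deleting its end in \<open>H\<close> gives one with another end in \<open>H\<close>. Two of these three edges are disjoint.
\<close>

lemma disjoint_attachments:
  assumes "X \<subseteq> V" "H \<subseteq> V" "X \<inter> H = {}" and closed: "\<And>h y. \<lbrakk>h \<in> H; E h y\<rbrakk> \<Longrightarrow> y \<in> X \<union> H"
    and two: "\<And>w. H - {w} \<noteq> {}" "\<And>w. X - {w} \<noteq> {}"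
  obtains u v h k where "u \<in> X" "v \<in> X" "u \<noteq> v" "h \<in> H" "k \<in> H" "h \<noteq> k" "E u h" "E v k"
proof -
  have attach: "\<exists>h\<in>H - {w}. \<exists>u\<in>X - {w}. E u h" for w
  proof -
    have "\<exists>x\<in>H - {w}. \<exists>y\<in>V - {w} - (H - {w}). E x y"
      by (rule crossing) (use assms(1-3) two[of w] in auto)
    then show ?thesis using closed sym by blast
  qed
  obtain x where "x \<in> X" using two(2) by blast
  obtain u h where uh: "u \<in> X" "h \<in> H" "E u h" using attach[of x] by blast
  obtain v k where vk: "v \<in> X - {u}" "k \<in> H" "E v k" using attach[of u] by blast
  obtain t l where tl: "t \<in> X" "l \<in> H - {h}" "E t l" using attach[of h] by blast
  show ?thesis
  proof (cases "k = h")
    case False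
    then show ?thesis using that[of u v h k] uh vk by auto
  next
    case True
    then show ?thesis using that[of u t h l] that[of v t h l] uh vk tl by (cases "t = u") auto
  qed
qed

text \<open>
  Some vertex \<open>c\<close> has two neighbours, and they are joined by a path that avoids \<open>c\<close>.
\<close>

lemma cyc_exists: "\<exists>C. cyc C"
proof -
  have big: "V - {a, b} \<noteq> {}" for a b
  proof
    assume "V - {a, b} = {}"
    then have "card V \<le> card {a, b}" by (intro card_mono) auto
    also have "\<dots> \<le> 2" by (simp add: card_insert_if)
    finally show False using card_V by simp
  qed
  then obtain c a where ca: "c \<in> V" "a \<in> V" "c \<noteq> a" by blast
  have nbr: "\<exists>b. E c b \<and> b \<noteq> w" if "w \<noteq> c" for w
    using crossing[of "{c}" w] big[of w c] ca(1) that by auto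
  obtain b1 where b1: "E c b1" using nbr[of a] ca by blast
  then have "b1 \<noteq> c" using irrefl by blast
  then obtain b2 where b2: "E c b2" "b2 \<noteq> b1" using nbr[of b1] by blast
  have V: "b1 \<in> V - {c}" "b2 \<in> V - {c}" using b1 b2 E_in_V sym irrefl by blast+
  define R where "R = (\<lambda>x y. E x y \<and> y \<noteq> c)"
  have "R\<^sup>*\<^sup>* b1 b2"
  proof (rule ccontr)
    assume n: "\<not> R\<^sup>*\<^sup>* b1 b2"
    define S where "S = {z \<in> V - {c}. R\<^sup>*\<^sup>* b1 z}"
    have "\<exists>x\<in>S. \<exists>y\<in>V - {c} - S. E x y"
      by (rule crossing) (use n V in \<open>auto simp: S_def\<close>)
    then obtain x y where xy: "x \<in> S" "y \<in> V - {c} - S" "E x y" by blast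
    then have "R\<^sup>*\<^sup>* b1 y"
      by (auto simp: S_def R_def intro: rtranclp.rtrancl_into_rtrancl)
    then show False using xy by (auto simp: S_def)
  qed
  then obtain P where P: "P \<noteq> []" "hd P = b1" "last P = b2" "distinct P" "successively R P"
    by (rule rtranclp_distinct_path)
  obtain q P' where PP: "P = b1 # q # P'"
    using P(1-3) b2 by (cases P; cases "tl P") auto
  have "c \<notin> set (b # Q)" if "successively R (b # Q)" "b \<noteq> c" for b Q
    using that by (induction Q arbitrary: b) (auto simp: R_def)
  from this[of b1 "q # P'"] have "c \<notin> set P" using P(5) \<open>b1 \<noteq> c\<close> unfolding PP by blast
  moreover have "successively E P" by (rule successively_mono[OF P(5)]) (simp add: R_def)
  ultimately have "cyc (c # P)"
    using P b1 sym[OF b2(1)] PP by (auto simp: cyc_def)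
  then show ?thesis ..
qed

end

locale two_connected_P5_W_free = two_connected + P5_W_free
begin

theorem longest_dominating_cyc:
  "\<exists>C. cyc C \<and> (\<forall>C'. cyc C' \<longrightarrow> length C' \<le> length C) \<and> (\<forall>x y. E x y \<longrightarrow> x \<in> set C \<or> y \<in> set C)"
proof -
  define missed where "missed C = {(x, y). E x y \<and> x \<notin> set C \<and> y \<notin> set C}" for C :: "'a list"
  have fin: "finite (missed C)" for C
    by (rule finite_subset[of _ "V \<times> V"]) (use finite_V E_in_V sym in \<open>auto simp: missed_def\<close>)
  obtain C1 where "cyc C1" using cyc_exists by blast
  then have "\<exists>C. cyc C \<and> (\<forall>D. cyc D \<longrightarrow> length D \<le> length C)"
    by (rule ex_has_greatest_nat[where b = "Suc (card V)"]) (simp add: length_cyc_le less_Suc_eq_le)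
  then obtain C0 where C0: "cyc C0" "\<And>C. cyc C \<Longrightarrow> length C \<le> length C0" by blast
  then obtain C where C: "cyc C" "length C = length C0"
      and least: "\<And>D. \<lbrakk>cyc D; length D = length C0\<rbrakk> \<Longrightarrow> card (missed C) \<le> card (missed D)"
    using ex_has_least_nat[of "\<lambda>C. cyc C \<and> length C = length C0" C0 "\<lambda>C. card (missed C)"] by blast
  have card: "card (set C) = length C0" using C distinct_card[of C] by (simp add: cyc_def)
  interpret extremal_cycle E "set C"
  proof
    fix ys assume "cyc ys" then show "length ys \<le> card (set C)" using C0 card by simp
  next
    fix ys h k
    assume ys: "cyc ys" "length ys = card (set C)"
      and closed: "\<And>x y. \<lbrakk>x \<in> set C - set ys; E x y\<rbrakk> \<Longrightarrow> y \<in> set ys"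
      and hk: "h \<in> set ys - set C" "k \<notin> set C"
    show "\<not> E h k"
    proof
      assume "E h k"
      then have "(h, k) \<in> missed C - missed ys" using hk by (simp add: missed_def)
      moreover have "missed ys \<subseteq> missed C" using closed sym by (fastforce simp: missed_def)
      ultimately have "card (missed ys) < card (missed C)" by (intro psubset_card_mono fin) auto
      then show False using least[of ys] ys card by simp
    qed
  qed
  have "False" if xy: "E x y" "x \<notin> set C" "y \<notin> set C" for x y
  proof -
    let ?H = "{z. linked x z}"
    have H: "x \<in> ?H" "y \<in> ?H" "x \<noteq> y" using xy irrefl by (auto simp: linked_def)
    have out: "?H \<inter> set C = {}" using linked_outside xy(2) by blast
    have V: "?H \<subseteq> V"
    proof
      fix z assume "z \<in> ?H"
      then have "linked x z" by simp
      then show "z \<in> V"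
        unfolding linked_def by (induction rule: rtranclp_induct) (use xy E_in_V sym in blast)+
    qed
    have closed: "z \<in> set C \<union> ?H" if "h \<in> ?H" "E h z" for h z
      using that out unfolding linked_def by (auto intro: rtranclp.rtrancl_into_rtrancl)
    have two: "set C - {w} \<noteq> {}" for w
    proof
      assume "set C - {w} = {}"
      then have "card (set C) \<le> card {w}" by (intro card_mono) auto
      then show False using C card by (simp add: cyc_def)
    qed
    have two_H: "?H - {w} \<noteq> {}" for w using H by (cases "w = x") auto
    obtain u v h k where "u \<in> set C" "v \<in> set C" "u \<noteq> v" "h \<in> ?H" "k \<in> ?H" "h \<noteq> k" "E u h" "E v k"
      by (rule disjoint_attachments[OF cyc_subset_V[OF C(1)] V _ closed two_H two]) (use out in auto)
    then show False using no_edge_outside[OF C(1) refl xy] by simp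
  qed
  then show ?thesis using C C0 by (intro exI[of _ C]) auto
qed

end

section \<open>Cycles and induced subgraphs of the digraph library\<close>

lemma pcas_zip_tl: "pcas u (zip (u # xs) xs) (last (u # xs))"
  by (induction xs arbitrary: u) auto

lemma pawalk_verts_zip_tl: "pawalk_verts u (zip (u # xs) xs) = u # xs"
  by (induction xs arbitrary: u) auto

lemma set_zip_tl: "successively (\<lambda>x y. (x, y) \<in> A) (u # xs) \<Longrightarrow> set (zip (u # xs) xs) \<subseteq> A"
  by (induction xs arbitrary: u) auto

lemma pcas_arcs:
  assumes "pcas u p v" "set p \<subseteq> A"
  shows "pawalk_verts u p = map fst p @ [v]" "successively (\<lambda>x y. (x, y) \<in> A) (map fst p @ [v])"
  using assms
proof (induction p arbitrary: u)
  case (Cons e p)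
  { case 1 then show ?case using Cons.IH(1)[of "snd e"] by simp }
  { case 2 then show ?case using Cons.IH(2)[of "snd e"] by (cases p) auto }
qed auto

context pair_graph
begin

abbreviation adj :: "'a \<Rightarrow> 'a \<Rightarrow> bool" where
  "adj x y \<equiv> (x, y) \<in> parcs G"

sublocale adj: sym_rel adj
  by unfold_locales (auto dest: arcs_symmetric pair_no_loops)

lemma graph_cycle_imp_cyc:
  assumes "graph_cycle G C" shows "adj.cyc (map fst C)"
proof -
  obtain u where u: "awalk u C u" "distinct (tl (pawalk_verts u C))" "C \<noteq> []" "3 \<le> length C"
    using assms by (auto simp: graph_cycle_def cycle_def)
  then have p: "pcas u C u" "set C \<subseteq> parcs G" by (auto simp: awalk_def)
  note arcs = pcas_arcs[OF p]
  have "hd (map fst C) = u" using p(1) u(3) by (cases C) auto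
  then show ?thesis
    using u arcs by (cases C) (auto simp: adj.cyc_def successively_append_iff successively_Cons)
qed

text \<open>
  The arcs of a cycle are the pairs of consecutive vertices of the list, closed up by repeating its head.
\<close>

lemma cyc_imp_graph_cycle:
  assumes "adj.cyc xs"
  obtains C where "graph_cycle G C" "length C = length xs" "cycle_verts C = set xs"
proof -
  obtain u ys where xs: "xs = u # ys" using assms by (cases xs) (auto simp: adj.cyc_def)
  define zs where "zs = ys @ [u]"
  define C where "C = zip (u # zs) zs"
  have c: "distinct (u # ys)" "successively adj (u # zs)" "3 \<le> length (u # ys)"
    using assms by (auto simp: adj.cyc_def xs zs_def successively_append_iff successively_Cons hd_append)
  have "u \<in> pverts G" using c(2) by (cases ys) (auto simp: zs_def in_arcsD1)
  then have "awalk u C u"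
    using pcas_zip_tl[of u zs] set_zip_tl[OF c(2)] by (simp add: awalk_def C_def zs_def)
  moreover have "distinct (tl (pawalk_verts u C))"
    using c(1) by (simp add: C_def pawalk_verts_zip_tl) (simp add: zs_def)
  ultimately have "graph_cycle G C"
    using c(3) by (auto simp: graph_cycle_def cycle_def C_def zs_def)
  moreover have "map fst C = xs"
    by (simp add: C_def map_fst_zip_take xs) (simp add: zs_def)
  then have "length C = length xs" "cycle_verts C = set xs"
    by (auto simp: cycle_verts_def simp flip: length_map[of fst C] set_map)
  ultimately show ?thesis by (rule that)
qed

lemma connected_imp_crossing:
  assumes "Digraph_Component.connected (with_proj G \<restriction> W)" "S \<subseteq> W" "S \<noteq> {}" "S \<noteq> W"
  shows "\<exists>x\<in>S. \<exists>y\<in>W - S. adj x y"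
proof (rule ccontr)
  assume no: "\<not> ?thesis"
  let ?M = "mk_symmetric (with_proj G \<restriction> W)"
  obtain x y where xy: "x \<in> S" "y \<in> W - S" using assms by blast
  have arcs: "adj a b \<and> a \<in> W \<and> b \<in> W" if "(a, b) \<in> parcs ?M" for a b
    using that adj.sym by (auto simp: mk_symmetric_def)
  have "(x, y) \<in> rtrancl_on W (arcs_ends (with_proj ?M))"
    using assms(1,2) xy
    by (auto simp: Digraph_Component.connected_def strongly_connected_def reachable_def mk_symmetric_def)
  then have "y \<in> S"
  proof (induction rule: rtrancl_on_induct)
    case base
    show ?case using xy(1) .
  next
    case (step b c)
    then have "(b, c) \<in> parcs ?M" by (auto simp: arcs_ends_def arc_to_ends_def)
    then show ?case using arcs[of b c] no step.IH by blast
  qed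
  then show False using xy(2) by simp
qed

lemma k_connected_2_crossing:
  assumes "k_connected 2 G" "S \<subseteq> pverts G - {w}" "S \<noteq> {}" "S \<noteq> pverts G - {w}"
  shows "\<exists>x\<in>S. \<exists>y\<in>pverts G - {w} - S. adj x y"
proof (rule connected_imp_crossing[OF _ assms(2-4)])
  have "card (pverts G \<inter> {w}) < 2"
    by (rule le_less_trans[OF card_mono[of "{w}"]]) auto
  then have "Digraph_Component.connected (with_proj G \<restriction> (pverts G - pverts G \<inter> {w}))"
    using assms(1) by (simp add: k_connected_def)
  then show "Digraph_Component.connected (with_proj G \<restriction> (pverts G - {w}))"
    by (simp add: Diff_Int)
qed

lemma no_induced_P5:
  assumes "\<not> has_induced (path_graph 5) G" "adj a b" "adj b c" "adj c d" "adj d e"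
  shows "adj a c \<or> adj a d \<or> adj a e \<or> adj b d \<or> adj b e \<or> adj c e"
proof (rule ccontr)
  assume n: "\<not> ?thesis"
  define f where "f i = [a, b, c, d, e] ! i" for i
  have sym: "adj x y \<longleftrightarrow> adj y x" for x y by (rule adj.E_commute)
  have n': "\<not> adj a c" "\<not> adj c a" "\<not> adj a d" "\<not> adj d a" "\<not> adj a e" "\<not> adj e a"
    "\<not> adj b d" "\<not> adj d b" "\<not> adj b e" "\<not> adj e b" "\<not> adj c e" "\<not> adj e c"
    "adj b a" "adj c b" "adj d c" "adj e d"
    using n assms(2-5) sym by blast+
  have v: "pverts (path_graph 5) = {0, 1, 2, 3, 4}" by (auto simp: path_graph_def)
  have "distinct [a, b, c, d, e]" using n' assms(2-5) adj.irrefl by auto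
  then have "inj_on f (pverts (path_graph 5))"
    by (auto simp: v inj_on_def f_def)
  moreover have "f ` pverts (path_graph 5) \<subseteq> pverts G"
    using assms(2-5) in_arcsD1 in_arcsD2 by (auto simp: v f_def)
  moreover have "\<forall>i\<in>pverts (path_graph 5). \<forall>j\<in>pverts (path_graph 5).
      (i, j) \<in> parcs (path_graph 5) \<longleftrightarrow> adj (f i) (f j)"
    unfolding v using n' assms(2-5) adj.irrefl by (simp add: path_graph_def f_def)
  ultimately have "has_induced (path_graph 5) G"
    using has_induced_iff[of "path_graph 5" G] pair_graph_path_graph pair_wf_digraph_axioms
    by (auto simp: pair_graph_def pair_digraph_def pair_fin_digraph_def)
  then show False using assms(1) by simp
qed

lemma no_induced_W:
  assumes "\<not> has_induced W_star G"
    and "adj c a1" "adj c a2" "adj a1 a2" "adj c b1" "adj c b2" "adj b1 b2" "adj c d"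
  shows "adj a1 b1 \<or> adj a1 b2 \<or> adj a2 b1 \<or> adj a2 b2 \<or> adj d a1 \<or> adj d a2 \<or> adj d b1 \<or> adj d b2"
proof (rule ccontr)
  assume n: "\<not> ?thesis"
  define f where "f i = [c, a1, a2, b1, b2, d] ! i" for i
  have sym: "adj x y \<longleftrightarrow> adj y x" for x y by (rule adj.E_commute)
  have n': "\<not> adj a1 b1" "\<not> adj a1 b2" "\<not> adj a2 b1" "\<not> adj a2 b2" "\<not> adj d a1" "\<not> adj d a2"
    "\<not> adj d b1" "\<not> adj d b2" "\<not> adj b1 a1" "\<not> adj b2 a1" "\<not> adj b1 a2" "\<not> adj b2 a2"
    "\<not> adj a1 d" "\<not> adj a2 d" "\<not> adj b1 d" "\<not> adj b2 d"
    "adj a1 c" "adj a2 c" "adj a2 a1" "adj b1 c" "adj b2 c" "adj b2 b1" "adj d c"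
    using n assms(2-8) sym by blast+
  have v: "pverts W_star = {0, 1, 2, 3, 4, 5}" by (auto simp: W_star_def Let_def)
  have "distinct [c, a1, a2, b1, b2, d]" using n' assms(2-8) adj.irrefl by auto
  then have "inj_on f (pverts W_star)"
    by (auto simp: v inj_on_def f_def)
  moreover have "f ` pverts W_star \<subseteq> pverts G"
    using assms(2-8) in_arcsD1 in_arcsD2 by (auto simp: v f_def)
  moreover have "\<forall>i\<in>pverts W_star. \<forall>j\<in>pverts W_star.
      (i, j) \<in> parcs W_star \<longleftrightarrow> adj (f i) (f j)"
    unfolding v using n' assms(2-8) adj.irrefl by (simp add: W_star_def Let_def f_def)
  ultimately have "has_induced W_star G"
    using has_induced_iff[of W_star G] pair_graph_W_star pair_wf_digraph_axioms
    by (auto simp: pair_graph_def pair_digraph_def pair_fin_digraph_def)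
  then show False using assms(1) by simp
qed

end

theorem theorem1:
  fixes G :: "'a pair_pre_digraph"
  assumes "pair_graph G"
    and "k_connected 2 G"
    and "induced_free {path_graph 5, W_star} G"
  shows "\<exists>C. longest_cycle G C \<and> dominating_cycle G C"
proof -
  interpret pair_graph G by fact
  have "\<not> has_induced (path_graph 5) G" "\<not> has_induced W_star G"
    using assms(3) by (simp_all add: induced_free_def)
  then interpret two_connected_P5_W_free adj "pverts G"
  proof unfold_locales
    show "finite (pverts G)" by simp
    show "2 < card (pverts G)" using assms(2) by (simp add: k_connected_def)
    show "x \<in> pverts G" if "adj x y" for x y using that by (rule in_arcsD1)
    show "\<exists>x\<in>S. \<exists>y\<in>pverts G - {w} - S. adj x y"
      if "S \<subseteq> pverts G - {w}" "S \<noteq> {}" "S \<noteq> pverts G - {w}" for S w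
      using assms(2) that by (rule k_connected_2_crossing)
  qed (rule no_induced_P5 no_induced_W; assumption)+
  obtain C where C: "adj.cyc C" "\<And>C'. adj.cyc C' \<Longrightarrow> length C' \<le> length C"
      "\<And>x y. adj x y \<Longrightarrow> x \<in> set C \<or> y \<in> set C"
    using longest_dominating_cyc by blast
  obtain D where D: "graph_cycle G D" "length D = length C" "cycle_verts D = set C"
    using cyc_imp_graph_cycle[OF C(1)] .
  have "length D' \<le> length D" if "graph_cycle G D'" for D'
    using C(2)[OF graph_cycle_imp_cyc[OF that]] D(2) by simp
  then have "longest_cycle G D" using D(1) by (simp add: longest_cycle_def)
  moreover have "dominating_cycle G D"
    using D(1,3) C(3) by (auto simp: dominating_cycle_def)
  ultimately show ?thesis by blast
qed

end
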